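(* Let $d\ge 1$ be an integer and let $\lambda_1,\dots,\lambda_d\in(0,1]$ and $\phi_0,\dots,\phi_{2d}:[0,1]\to[0,1]$ be fixed Kolmogorov data as described in the context. For each integer $n\ge 0$ let $$Kp_n(x_1,\dots,x_d)=\sum_{q=0}^{2d}\Big(\sum_{i=1}^d\lambda_i\phi_q(x_i)\Big)^n,\qquad (x_1,\dots,x_d)\in[0,1]^d .$$ Then for every $f\in C([0,1]^d)$ and every $\epsilon>0$ there exists $K$ in the real linear span $\mathrm{span}\{Kp_n\}_{n\ge 0}$ such that $$\|f-K\|_\infty\le\epsilon .$$
   Context: Kolmogorov data (Kolmogorov superposition theorem, Lorentz's version): fix numbers $0<\lambda_p\le 1$, $p=1,\dots,d$, and strictly increasing functions $\phi_q:[0,1]\to[0,1]$, $q=0,\dots,2d$, each Hölder continuous with exponent $\alpha\in(0,1)$, with the property that for every $f\in C([0,1]^d)$ there exists $g\in C([0,d])$ with $f(x_1,\dots,x_d)=\sum_{q=0}^{2d} g\big(\sum_{p=1}^d\lambda_p\phi_q(x_p)\big)$ on $[0,1]^d$. Such data exist by Lorentz's version of the Kolmogorov superposition theorem. $C([0,1]^d)$ denotes the real-valued continuous functions on $[0,1]^d$ and $\|\cdot\|_\infty$ is the supremum norm on $[0,1]^d$. The functions $Kp_n$ are called Kolmogorov-monomials. The convention $t^0=1$ is used. *)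

theory Defs
  imports "HOL-Analysis.Analysis" "HOL-Library.Function_Algebras"
begin

text \<open>The dimension is \<open>d = CARD('d)\<close> for an arbitrary finite (nonempty) index type \<open>'d\<close>.
  Functions on \<open>[0,1]\<close> or on the cube are total HOL functions; only their values on the respective
  domain are constrained.\<close>

definition unit_cube :: "(real ^ 'd) set" where
  "unit_cube = {x. \<forall>p. x $ p \<in> {0..1}}"

definition holder_on :: "real \<Rightarrow> real set \<Rightarrow> (real \<Rightarrow> real) \<Rightarrow> bool" where
  "holder_on \<alpha> S h \<longleftrightarrow> (\<exists>C. \<forall>x\<in>S. \<forall>y\<in>S. \<bar>h x - h y\<bar> \<le> C * \<bar>x - y\<bar> powr \<alpha>)"

text \<open>The functions \<open>\<phi> q\<close> with \<open>q > 2 d\<close> are irrelevant.\<close>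

definition kolmogorov_data :: "real \<Rightarrow> ('d::finite \<Rightarrow> real) \<Rightarrow> (nat \<Rightarrow> real \<Rightarrow> real) \<Rightarrow> bool" where
  "kolmogorov_data \<alpha> lam \<phi> \<longleftrightarrow>
     0 < \<alpha> \<and> \<alpha> < 1 \<and>
     (\<forall>p. 0 < lam p \<and> lam p \<le> 1) \<and>
     (\<forall>q\<le>2 * CARD('d).
        \<phi> q ` {0..1} \<subseteq> {0..1} \<and> strict_mono_on {0..1} (\<phi> q) \<and> holder_on \<alpha> {0..1} (\<phi> q)) \<and>
     (\<forall>f :: real ^ 'd \<Rightarrow> real. continuous_on unit_cube f \<longrightarrow>
        (\<exists>g :: real \<Rightarrow> real. continuous_on {0..real CARD('d)} g \<and>
           (\<forall>x\<in>unit_cube. f x = (\<Sum>q\<le>2 * CARD('d). g (\<Sum>p\<in>UNIV. lam p * \<phi> q (x $ p))))))"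

definition Kp :: "('d::finite \<Rightarrow> real) \<Rightarrow> (nat \<Rightarrow> real \<Rightarrow> real) \<Rightarrow> nat \<Rightarrow> real ^ 'd \<Rightarrow> real" where
  "Kp lam \<phi> n x = (\<Sum>q\<le>2 * CARD('d). (\<Sum>i\<in>UNIV. lam i * \<phi> q (x $ i)) ^ n)"

text \<open>Real-valued functions form a real vector space under the pointwise operations; they are not
  an instance of class \<open>real_vector\<close>, so the library's span is taken from this interpretation.\<close>

definition fun_scale :: "real \<Rightarrow> ('a \<Rightarrow> real) \<Rightarrow> 'a \<Rightarrow> real" where
  "fun_scale c f = (\<lambda>x. c * f x)"

global_interpretation real_fun: vector_space fun_scale
  by unfold_locales (auto simp: fun_scale_def algebra_simps)

text \<open>Meaningful for functions bounded on the cube, in particular for continuous ones.\<close>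

definition sup_norm_cube :: "(real ^ 'd \<Rightarrow> real) \<Rightarrow> real" where
  "sup_norm_cube f = (SUP x\<in>unit_cube. \<bar>f x\<bar>)"

end

theory Submission
  imports Defs
begin

text \<open>Apply the Weierstrass theorem to the outer function \<open>g\<close> of the Kolmogorov representation of
  \<open>f\<close>: if a polynomial \<open>p\<close> is within \<open>\<epsilon> / (2 d + 1)\<close> of \<open>g\<close> on \<open>[0, d]\<close>, then replacing \<open>g\<close> by \<open>p\<close>
  in the \<open>2 d + 1\<close> outer terms changes \<open>f\<close> by at most \<open>\<epsilon>\<close>, and by linearity in \<open>p\<close> the result is a
  linear combination of Kolmogorov monomials.\<close>

text \<open>Explicit coefficients are needed because the same \<open>c k\<close> later weight the
  monomials \<open>Kp lam \<phi> k\<close>.\<close>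

lemma weierstrass_interval:
  fixes g :: "real \<Rightarrow> real"
  assumes "continuous_on {a..b} g" and "e > 0"
  shows "\<exists>c n. \<forall>t\<in>{a..b}. \<bar>g t - (\<Sum>k\<le>n. c k * t ^ k)\<bar> < e"
proof -
  obtain p where "real_polynomial_function p" and p: "\<And>t. t \<in> {a..b} \<Longrightarrow> \<bar>g t - p t\<bar> < e"
    using Stone_Weierstrass_real_polynomial_function[OF compact_Icc assms] by blast
  then obtain c n where "p = (\<lambda>t. \<Sum>k\<le>n. c k * t ^ k)"
    using real_polynomial_function_iff_sum by blast
  with p show ?thesis
    by (intro exI[of _ c] exI[of _ n]) simp
qed

text \<open>Each of the d summands is a product of two numbers in [0,1]. Hence the outer function is
  only evaluated where its polynomial approximation is valid.\<close>

lemma inner_sum_in_interval: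
  fixes lam :: "'d::finite \<Rightarrow> real"
  assumes "kolmogorov_data \<alpha> lam \<phi>" and "q \<le> 2 * CARD('d)" and "x \<in> unit_cube"
  shows "(\<Sum>p\<in>UNIV. lam p * \<phi> q (x $ p)) \<in> {0..real CARD('d)}"
proof -
  have lam: "0 < lam p" "lam p \<le> 1" for p
    using assms(1) by (simp_all add: kolmogorov_data_def)
  have "\<phi> q ` {0..1} \<subseteq> {0..1}"
    using assms(1,2) by (simp add: kolmogorov_data_def)
  moreover have "x $ p \<in> {0..1}" for p
    using assms(3) by (simp add: unit_cube_def)
  ultimately have phi: "\<phi> q (x $ p) \<in> {0..1}" for p
    by blast
  have term_bounds: "0 \<le> lam p * \<phi> q (x $ p)" "lam p * \<phi> q (x $ p) \<le> 1" for p
    using lam[of p] phi[of p] by (auto intro: mult_le_one)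
  show ?thesis
    using sum_nonneg[of UNIV "\<lambda>p. lam p * \<phi> q (x $ p)"]
      sum_bounded_above[of UNIV "\<lambda>p. lam p * \<phi> q (x $ p)" 1] term_bounds
    by simp
qed

lemma sum_Kp_eq:
  fixes lam :: "'d::finite \<Rightarrow> real"
  shows "(\<Sum>k\<le>n. fun_scale (c k) (Kp lam \<phi> k)) x =
    (\<Sum>q\<le>2 * CARD('d). \<Sum>k\<le>n. c k * (\<Sum>p\<in>UNIV. lam p * \<phi> q (x $ p)) ^ k)"
proof -
  \<comment> \<open>The left sum is taken in the function space, so evaluation at \<open>x\<close>
    must first be moved inside it.\<close>
  have "(\<Sum>k\<le>n. fun_scale (c k) (Kp lam \<phi> k)) x = (\<Sum>k\<le>n. fun_scale (c k) (Kp lam \<phi> k) x)"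
    by (induction n) simp_all
  then show ?thesis
    by (simp only: fun_scale_def Kp_def sum_distrib_left sum.swap[of _ "{..n}"])
qed

lemma sup_norm_cube_le:
  assumes "\<And>x. x \<in> unit_cube \<Longrightarrow> \<bar>h x\<bar> \<le> e"
  shows "sup_norm_cube h \<le> e"
proof -
  \<comment> \<open>A supremum of reals is bounded by an upper bound of the set only if the set is
    nonempty.\<close>
  have "0 \<in> unit_cube"
    by (simp add: unit_cube_def)
  then show ?thesis
    unfolding sup_norm_cube_def using assms by (intro cSUP_least) auto
qed

theorem theorem4:
  fixes \<alpha> :: real
    and lam :: "'d::finite \<Rightarrow> real"
    and \<phi> :: "nat \<Rightarrow> real \<Rightarrow> real"
    and f :: "real ^ 'd \<Rightarrow> real"
    and \<epsilon> :: real
  assumes "kolmogorov_data \<alpha> lam \<phi>"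
    and "continuous_on unit_cube f"
    and "\<epsilon> > 0"
  shows "\<exists>K \<in> real_fun.span (range (Kp lam \<phi>)). sup_norm_cube (\<lambda>x. f x - K x) \<le> \<epsilon>"
proof -
  let ?d = "CARD('d)"
  let ?s = "\<lambda>q x. \<Sum>p\<in>UNIV. lam p * \<phi> q (x $ p)"
  have "\<exists>g. continuous_on {0..real ?d} g \<and> (\<forall>x\<in>unit_cube. f x = (\<Sum>q\<le>2 * ?d. g (?s q x)))"
    using assms(1,2) by (simp add: kolmogorov_data_def)
  then obtain g where rep: "continuous_on {0..real ?d} g \<and>
      (\<forall>x\<in>unit_cube. f x = (\<Sum>q\<le>2 * ?d. g (?s q x)))" ..
  note g = conjunct1[OF rep] and f_eq = bspec[OF conjunct2[OF rep]]
  \<comment> \<open>The index \<open>q\<close> runs from 0 to 2d inclusive, so 2d + 1 errors share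
    \<open>\<epsilon>\<close>.\<close>
  define e where "e = \<epsilon> / real (2 * ?d + 1)"
  have "e > 0"
    using assms(3) by (simp add: e_def)
  then obtain c n where approx: "\<forall>t\<in>{0..real ?d}. \<bar>g t - (\<Sum>k\<le>n. c k * t ^ k)\<bar> < e"
    using weierstrass_interval[OF g] by meson
  define K where "K = (\<Sum>k\<le>n. fun_scale (c k) (Kp lam \<phi> k))"
  have "K \<in> real_fun.span (range (Kp lam \<phi>))"
    unfolding K_def by (intro real_fun.span_sum real_fun.span_scale real_fun.span_base) simp
  moreover have "sup_norm_cube (\<lambda>x. f x - K x) \<le> \<epsilon>"
  proof (rule sup_norm_cube_le)
    fix x :: "real ^ 'd"
    assume x: "x \<in> unit_cube"
    \<comment> \<open>With the sum over \<open>q\<close> outermost in both \<open>f\<close> and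
      \<open>K\<close>, the error splits into one approximation error of \<open>g\<close> per
      \<open>q\<close>.\<close>
    have "\<bar>f x - K x\<bar> = \<bar>\<Sum>q\<le>2 * ?d. g (?s q x) - (\<Sum>k\<le>n. c k * ?s q x ^ k)\<bar>"
      unfolding K_def sum_Kp_eq f_eq[OF x] by (simp only: sum_subtractf)
    also have "\<dots> \<le> (\<Sum>q\<le>2 * ?d. e)"
      by (intro order_trans[OF sum_abs] sum_mono less_imp_le[OF bspec[OF approx]]
          inner_sum_in_interval[OF assms(1) _ x]) simp
    also have "\<dots> = real (2 * ?d + 1) * e"
      by simp
    also have "\<dots> = \<epsilon>"
      by (simp add: e_def)
    finally show "\<bar>f x - K x\<bar> \<le> \<epsilon>" .
  qed
  ultimately show ?thesis
    by blast
qed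

end
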